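(* For all odd integers $n\geq 3$ and every $\lambda>-\frac12$, the best Markov constant satisfies $$\frac{(n+1)\big(n+\lambda+\frac12\big)^2(n+2\lambda+1)}{(2\lambda+1)(2\lambda+5)}\leq c_n^2(\lambda)\leq\frac{(n+1)^{3/2}(n+2\lambda+1)^2(n+2\lambda'+1)^{1/2}}{2(2\lambda+1)\sqrt{2\lambda+5}},$$ where $\lambda'=\max\{\lambda,0\}$.
   Context: $\mathcal{P}_n$ denotes the class of real algebraic polynomials of degree at most $n$. For $\lambda>-1/2$, $w_\lambda(t)=(1-t^2)^{\lambda-1/2}$ on $(-1,1)$ and $\Vert f\Vert_{w_\lambda}=\big(\int_{-1}^1 w_\lambda(t)f^2(t)\,dt\big)^{1/2}$. The best Markov constant is $c_n(\lambda)=\sup\{\Vert p'\Vert_{w_\lambda}/\Vert p\Vert_{w_\lambda}: p\in\mathcal{P}_n,\ p\neq 0\}$. *)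

theory Defs
  imports "HOL-Analysis.Analysis" "HOL-Computational_Algebra.Polynomial"
begin

definition gegen_weight :: "real \<Rightarrow> real \<Rightarrow> real" where
  "gegen_weight lam t = (1 - t\<^sup>2) powr (lam - 1/2)"

definition wnorm :: "real \<Rightarrow> (real \<Rightarrow> real) \<Rightarrow> real" where
  "wnorm lam f = sqrt (LINT t:{-1<..<1}|lborel. gegen_weight lam t * (f t)\<^sup>2)"

definition markov_const :: "nat \<Rightarrow> real \<Rightarrow> real" where
  "markov_const n lam = (SUP p\<in>{p :: real poly. degree p \<le> n \<and> p \<noteq> 0}.
      wnorm lam (poly (pderiv p)) / wnorm lam (poly p))"

end

theory Submission
  imports Defs
begin

text \<open>
  Expand in Gegenbauer polynomials \<open>F\<^sub>0, F\<^sub>1, \<dots>\<close>, which are orthogonal for the weight and satisfy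
  \<open>F'\<^sub>m = \<Sum> e\<^sub>k F\<^sub>k\<close>, summed over \<open>k < m\<close> of parity opposite to \<open>m\<close>.  The Gram matrix of the
  normalised derivatives splits into an even and an odd block, with entries depending only on the
  smaller of the two indices.  Let \<open>B\<close> be the odd block.  Both \<open>tr B\<close> and \<open>tr B\<^sup>2\<close> telescope to
  explicit polynomials, and for odd \<open>n\<close> the Frobenius norm of \<open>B\<close> dominates that of the even block.
  Hence the squared Markov constant, being the largest eigenvalue of the Gram matrix, lies between
  \<open>tr B\<^sup>2 / tr B\<close> and \<open>(tr B\<^sup>2)\<^sup>1\<^sup>/\<^sup>2\<close>.
\<close>

section \<open>The weighted integral of a polynomial\<close>

text \<open>The form in which the fundamental theorem for improper interval integrals takes its
  boundary values.\<close>

lemma Icc_limits_ereal: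
  fixes F :: "real \<Rightarrow> real"
  assumes "continuous_on {a..b} F" "a < b"
  shows "((F \<circ> real_of_ereal) \<longlongrightarrow> F a) (at_right (ereal a))"
    and "((F \<circ> real_of_ereal) \<longlongrightarrow> F b) (at_left (ereal b))"
  using continuous_on_Icc_at_rightD[OF assms] continuous_on_Icc_at_leftD[OF assms]
  by (simp_all add: ereal_tendsto_simps1)

locale gegenbauer =
  fixes lam :: real
  assumes lam_gt: "lam > -1/2"
begin

lemma continuous_on_weight: "continuous_on {-1<..<1} (gegen_weight lam)"
  unfolding gegen_weight_def
  by (intro continuous_intros) (auto simp: power2_eq_1_iff)

lemma weight_pos: "t \<in> {-1<..<1} \<Longrightarrow> gegen_weight lam t > 0"
  unfolding gegen_weight_def by (auto simp: power2_eq_1_iff)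

text \<open>For a negative exponent the weight is dominated by \<open>g\<close>, a sum of one-sided
  powers with an explicit antiderivative; the constant 1 added to \<open>g\<close> covers the
  exponents \<open>a \<ge> 0\<close>.\<close>

lemma set_integrable_weight: "set_integrable lborel {-1<..<1} (gegen_weight lam)"
proof -
  define a where "a = lam - 1/2"
  have a: "a > -1" using lam_gt by (simp add: a_def)
  define g where "g = (\<lambda>t::real. (1 - t) powr a + (1 + t) powr a)"
  have g_int: "set_integrable lborel {-1<..<1} g"
  proof -
    define F where "F = (\<lambda>t::real. ((1 + t) powr (a+1) - (1 - t) powr (a+1)) / (a + 1))"
    have cont: "continuous_on {-1..1} F" unfolding F_def
      by (rule continuous_intros continuous_on_powr' | use a in force)+
    have "set_integrable lborel (einterval (ereal (-1)) (ereal 1)) g"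
    proof (rule interval_integral_FTC_nonneg(1))
      fix x :: real assume "ereal (-1) < ereal x" "ereal x < ereal 1"
      hence x: "-1 < x" "x < 1" by auto
      show "(F has_real_derivative g x) (at x)" unfolding F_def g_def
      proof (rule DERIV_cong)
        show "((\<lambda>t. ((1 + t) powr (a+1) - (1 - t) powr (a+1)) / (a+1)) has_real_derivative
            ((a+1) * (1 + x) powr a + (a+1) * (1 - x) powr a) / (a+1)) (at x)"
          using x a by (auto intro!: derivative_eq_intros)
        show "((a+1) * (1 + x) powr a + (a+1) * (1 - x) powr a) / (a+1)
            = (1 - x) powr a + (1 + x) powr a"
          using a by (simp add: distrib_left[symmetric])
      qed
      show "isCont g x" unfolding g_def using x by (intro continuous_intros) auto
    next
      show "AE x in lborel. ereal (-1) < ereal x \<longrightarrow> ereal x < ereal 1 \<longrightarrow> 0 \<le> g x"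
        by (auto simp: g_def)
    qed (use Icc_limits_ereal[OF cont] in auto)
    thus ?thesis by simp
  qed
  have one_int: "set_integrable lborel {-1<..<1} (\<lambda>t::real. 1::real)"
    unfolding set_integrable_def by simp
  show ?thesis
  proof (rule set_integrable_bound)
    show "set_integrable lborel {-1<..<1} (\<lambda>t. g t + 1)"
      using g_int one_int by (rule set_integral_add(1))
    show "set_borel_measurable lborel {-1<..<1} (gegen_weight lam)"
      using set_measurable_continuous_on[OF _ continuous_on_weight]
      by (simp add: set_borel_measurable_def)
    have "gegen_weight lam x \<le> g x + 1" if x: "x \<in> {-1<..<1}" for x
    proof (cases "a \<ge> 0")
      case True
      have "0 \<le> 1 - x\<^sup>2" "1 - x\<^sup>2 \<le> 1"
        using x by (auto simp: abs_square_le_1)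
      hence "(1 - x\<^sup>2) powr a \<le> 1 powr a" using True by (intro powr_mono2) auto
      thus ?thesis by (auto simp: gegen_weight_def g_def a_def intro: add_nonneg_nonneg order_trans)
    next
      case False
      hence *: "(1 - x\<^sup>2) powr a \<le> y powr a" if "0 < y" "y \<le> 1 - x\<^sup>2" for y
        using that by (intro powr_mono2') auto
      have "(1 - x\<^sup>2) powr a \<le> g x"
      proof (cases "x \<ge> 0")
        case True
        hence "x * x \<le> x * 1" using x by (intro mult_left_mono) auto
        with * [of "1 - x"] x show ?thesis
          by (auto simp: g_def power2_eq_square intro: add_increasing2)
      next
        case False
        hence "(-x) * (-x) \<le> (-x) * 1" using x by (intro mult_left_mono) auto
        with * [of "1 + x"] x show ?thesis
          by (auto simp: g_def power2_eq_square intro: add_increasing)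
      qed
      thus ?thesis by (simp add: gegen_weight_def a_def)
    qed
    thus "AE x in lborel. x \<in> {-1<..<1} \<longrightarrow> norm (gegen_weight lam x) \<le> norm (g x + 1)"
      using weight_pos by (intro AE_I2) (fastforce simp: g_def)
  qed
qed

lemma set_integrable_weight_poly:
  "set_integrable lborel {-1<..<1} (\<lambda>t. gegen_weight lam t * poly p t)"
proof -
  have "bounded (poly p ` {-1..1::real})"
    by (intro compact_imp_bounded compact_continuous_image continuous_intros) auto
  then obtain B where B: "\<And>t. t \<in> {-1..1} \<Longrightarrow> \<bar>poly p t\<bar> \<le> B"
    unfolding bounded_iff by (metis image_eqI real_norm_def)
  show ?thesis
  proof (rule set_integrable_bound)
    show "set_integrable lborel {-1<..<1} (\<lambda>t. gegen_weight lam t * B)"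
      using set_integrable_weight by (intro set_integrable_mult_left)
    show "set_borel_measurable lborel {-1<..<1} (\<lambda>t. gegen_weight lam t * poly p t)"
      using set_measurable_continuous_on[of "{-1<..<1}" "\<lambda>t. gegen_weight lam t * poly p t"]
      by (simp add: set_borel_measurable_def continuous_on_mult continuous_on_weight continuous_on_poly)
    have "\<bar>poly p x\<bar> \<le> \<bar>B\<bar>" if "x \<in> {-1<..<1}" for x
      using B[of x] that by auto
    thus "AE x in lborel. x \<in> {-1<..<1} \<longrightarrow>
        norm (gegen_weight lam x * poly p x) \<le> norm (gegen_weight lam x * B)"
      by (intro AE_I2) (simp add: abs_mult mult_left_mono)
  qed
qed

definition wint :: "real poly \<Rightarrow> real" where
  "wint p = (LINT t:{-1<..<1}|lborel. gegen_weight lam t * poly p t)"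

lemma wint_add: "wint (p + q) = wint p + wint q"
  using set_integral_add(2)[OF set_integrable_weight_poly set_integrable_weight_poly, of p q]
  by (simp add: wint_def distrib_left)

lemma wint_smult: "wint (smult c p) = c * wint p"
  using set_integral_mult_right[of lborel "{-1<..<1}" c "\<lambda>t. gegen_weight lam t * poly p t"]
  by (simp add: wint_def mult.left_commute)

lemma wint_0: "wint 0 = 0"
  by (simp add: wint_def)

lemma wint_minus: "wint (- p) = - wint p"
  using wint_smult[of "-1" p] by simp

lemma wint_diff: "wint (p - q) = wint p - wint q"
  using wint_add[of p "-q"] by (simp add: wint_minus)

lemma wint_sum: "wint (\<Sum>i\<in>A. f i) = (\<Sum>i\<in>A. wint (f i))"
  by (induction A rule: infinite_finite_induct) (simp_all add: wint_0 wint_add)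

lemma wint_square_nonneg: "wint (p * p) \<ge> 0"
  unfolding wint_def set_lebesgue_integral_def
  by (intro integral_nonneg_AE AE_I2) (auto simp: indicator_def gegen_weight_def)

lemma wnorm_poly: "wnorm lam (poly p) = sqrt (wint (p * p))"
  by (simp add: wnorm_def wint_def power2_eq_square)

lemma wint_1_pos: "wint 1 > 0"
proof -
  let ?f = "\<lambda>t. indicator {-1<..<1} t *\<^sub>R gegen_weight lam t"
  have int: "integrable lborel ?f"
    using set_integrable_weight by (simp add: set_integrable_def)
  have nonneg: "AE t in lborel. 0 \<le> ?f t"
    by (intro AE_I2) (auto simp: gegen_weight_def)
  have "wint 1 = integral\<^sup>L lborel ?f"
    by (simp add: wint_def set_lebesgue_integral_def)
  moreover have "integral\<^sup>L lborel ?f \<noteq> 0"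
  proof
    assume "integral\<^sup>L lborel ?f = 0"
    hence "AE t in lborel. ?f t = 0"
      using integral_nonneg_eq_0_iff_AE[OF int nonneg] by simp
    hence "AE t in lborel. t \<notin> {-1<..<1::real}"
      by eventually_elim (use weight_pos in \<open>force simp: indicator_def split: if_splits\<close>)
    hence "emeasure lborel {-1<..<1::real} = 0"
      by (subst (asm) AE_iff_measurable[OF _ refl])
        (auto simp: greaterThanLessThan_def greaterThan_def lessThan_def Collect_conj_eq)
    thus False by simp
  qed
  moreover have "integral\<^sup>L lborel ?f \<ge> 0" using nonneg by (rule integral_nonneg_AE)
  ultimately show ?thesis by simp
qed

text \<open>The integrand is the derivative of
  \<open>(1 - t\<^sup>2) powr (lam + 1/2) * poly q t\<close>, which vanishes at both endpoints
  because \<open>lam + 1/2 > 0\<close>.\<close>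

lemma wint_by_parts:
  "wint ([:1, 0, -1:] * pderiv q - smult (2 * lam + 1) ([:0, 1:] * q)) = 0"
proof -
  define F where "F = (\<lambda>t. (1 - t\<^sup>2) powr (lam + 1/2) * poly q t)"
  define r where "r = [:1, 0, -1:] * pderiv q - smult (2 * lam + 1) ([:0, 1:] * q)"
  have cont: "continuous_on {-1..1} F" unfolding F_def
    by (rule continuous_intros continuous_on_powr' | use lam_gt in \<open>force simp: abs_square_le_1\<close>)+
  have "(LBINT t=ereal (-1)..ereal 1. gegen_weight lam t * poly r t) = F 1 - F (-1)"
  proof (rule interval_integral_FTC_integrable)
    fix x :: real assume "ereal (-1) < ereal x" "ereal x < ereal 1"
    hence x: "-1 < x" "x < 1" by auto
    hence pos: "1 - x\<^sup>2 > 0" by (simp add: abs_square_less_1)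
    have split: "(1 - x\<^sup>2) powr (lam + 1/2) = gegen_weight lam x * (1 - x\<^sup>2)"
      using pos powr_add[of "1 - x\<^sup>2" "lam - 1/2" 1] by (simp add: gegen_weight_def add.commute)
    have "(F has_real_derivative gegen_weight lam x * poly r x) (at x)"
      unfolding F_def
      by (rule derivative_eq_intros poly_DERIV refl pos | simp add: split)+
         (use pos in \<open>simp add: r_def split gegen_weight_def algebra_simps power2_eq_square\<close>)
    thus "(F has_vector_derivative gegen_weight lam x * poly r x) (at x)"
      by (simp add: has_real_derivative_iff_has_vector_derivative)
    have "isCont (gegen_weight lam) x"
      using continuous_on_weight x by (simp add: continuous_on_eq_continuous_at)
    thus "isCont (\<lambda>x. gegen_weight lam x * poly r x) x" by (intro continuous_intros)
  qed (use Icc_limits_ereal[OF cont] set_integrable_weight_poly[of r] in auto)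
  hence "wint r = 0"
    by (simp add: wint_def F_def interval_lebesgue_integral_def)
  thus ?thesis by (simp only: r_def)
qed

end

section \<open>Gegenbauer polynomials\<close>

lemma poly_ext_real: "(\<And>t. poly p t = poly q t) \<Longrightarrow> p = (q :: real poly)"
  by (simp add: poly_eq_poly_eq_iff[symmetric] fun_eq_iff)

context gegenbauer
begin

text \<open>
  \<open>geg m\<close> is the classical \<open>C\<^sub>m / (2 * lam)\<close> for \<open>m \<ge> 1\<close>, which makes sense also at \<open>lam = 0\<close>.
  For \<open>m = 0\<close> that quotient would be \<open>1 / (2 * lam)\<close>; it is replaced by \<open>1\<close>, so that the factor
  \<open>m + 2 * lam\<close> in the recurrences becomes \<open>1\<close> at \<open>m = 0\<close>.
\<close>

definition gcoef :: "nat \<Rightarrow> real" where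
  "gcoef m = (if m = 0 then 1 else real m + 2 * lam)"

fun geg :: "nat \<Rightarrow> real poly" where
  "geg 0 = 1"
| "geg (Suc 0) = [:0, 1:]"
| "geg (Suc (Suc m)) = smult (1 / (real m + 2))
     (smult (2 * (real m + 1 + lam)) ([:0, 1:] * geg (Suc m)) - smult (gcoef m) (geg m))"

lemma geg_rec:
  "smult (real m + 2) (geg (Suc (Suc m))) =
     smult (2 * (real m + 1 + lam)) ([:0, 1:] * geg (Suc m)) - smult (gcoef m) (geg m)"
  by (simp add: add_nonneg_eq_0_iff)

lemma poly_geg_rec:
  "(real m + 2) * poly (geg (Suc (Suc m))) t =
     2 * (real m + 1 + lam) * t * poly (geg (Suc m)) t - gcoef m * poly (geg m) t"
  using arg_cong[OF geg_rec, of "\<lambda>p. poly p t" m]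
  by (simp del: geg.simps(3) add: mult.assoc)

lemma poly_pderiv_geg_rec:
  "(real m + 2) * poly (pderiv (geg (Suc (Suc m)))) t =
     2 * (real m + 1 + lam) * (poly (geg (Suc m)) t + t * poly (pderiv (geg (Suc m))) t)
     - gcoef m * poly (pderiv (geg m)) t"
  using arg_cong[OF geg_rec, of "\<lambda>p. poly (pderiv p) t" m]
  by (simp del: geg.simps(3) add: pderiv_smult pderiv_diff pderiv_pCons distrib_left mult_ac)

text \<open>The two identities feed each other in the induction: the differentiated recurrence and
  the first identity give the second at the next index, and with the recurrence itself this gives
  the first.\<close>

lemma geg_derivative_identities:
  "(real m + 1) * poly (geg (Suc m)) t = t * poly (pderiv (geg (Suc m))) t - poly (pderiv (geg m)) t
   \<and> poly (pderiv (geg (Suc m))) t = t * poly (pderiv (geg m)) t + gcoef m * poly (geg m) t"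
proof (induction m)
  case 0
  show ?case by (simp add: pderiv_pCons gcoef_def)
next
  case (Suc m)
  define F0 F1 F2 where "F0 = poly (geg m) t" "F1 = poly (geg (Suc m)) t" "F2 = poly (geg (Suc (Suc m))) t"
  define D0 D1 D2 where "D0 = poly (pderiv (geg m)) t" "D1 = poly (pderiv (geg (Suc m))) t"
    "D2 = poly (pderiv (geg (Suc (Suc m)))) t"
  note defs = F0_F1_F2_def D0_D1_D2_def
  have A: "(real m + 1) * F1 = t * D1 - D0" and B: "D1 = t * D0 + gcoef m * F0"
    using Suc.IH by (simp_all only: defs)
  have R: "(real m + 2) * F2 = 2 * (real m + 1 + lam) * t * F1 - gcoef m * F0"
    unfolding defs by (rule poly_geg_rec)
  have DR: "(real m + 2) * D2 = 2 * (real m + 1 + lam) * (F1 + t * D1) - gcoef m * D0"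
    unfolding defs by (rule poly_pderiv_geg_rec)
  \<comment> \<open>At \<open>m = 0\<close> the value of \<open>gcoef\<close> is exceptional, but
    \<open>D0\<close> is then zero.\<close>
  have "gcoef m * D0 = (real m + 2 * lam) * D0"
    by (simp add: gcoef_def D0_D1_D2_def)
  hence "(real m + 2) * D2 = 2 * (real m + 1 + lam) * (F1 + t * D1)
      - (real m + 2 * lam) * (t * D1 - (real m + 1) * F1)"
    using DR A by simp
  also have "\<dots> = (real m + 2) * (t * D1 + (real m + 1 + 2 * lam) * F1)"
    by algebra
  finally have B': "D2 = t * D1 + (real m + 1 + 2 * lam) * F1"
    by (simp add: add_nonneg_eq_0_iff)
  have "t * D2 - D1 = t * (t * D1) - D1 + (real m + 1 + 2 * lam) * t * F1"
    using B' by algebra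
  also have "t * D1 = (real m + 1) * F1 + D0" using A by simp
  also have "t * ((real m + 1) * F1 + D0) - D1 + (real m + 1 + 2 * lam) * t * F1
      = (real m + 2) * F2"
    using R B by algebra
  finally show ?case using B'
    unfolding defs[symmetric] by (simp add: gcoef_def algebra_simps)
qed

lemma geg_first_order:
  "[:1, 0, -1:] * pderiv (geg (Suc m)) =
     smult (gcoef m) (geg m) - smult (real m + 1) ([:0, 1:] * geg (Suc m))"
proof (rule poly_ext_real)
  fix t
  show "poly ([:1, 0, -1:] * pderiv (geg (Suc m))) t = 
     poly (smult (gcoef m) (geg m) - smult (real m + 1) ([:0, 1:] * geg (Suc m))) t"
    using geg_derivative_identities[of m t]
    by (simp only: poly_mult poly_diff poly_smult poly_pCons poly_0) algebra
qed

text \<open>Eliminates \<open>t * pderiv (geg (Suc m))\<close> between the identities at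
  \<open>m\<close> and \<open>Suc m\<close>; iterated in steps of two, this expands the derivative
  in Gegenbauer polynomials.\<close>

lemma pderiv_geg_step:
  "pderiv (geg (Suc (Suc m))) =
     pderiv (geg m) + smult (real (Suc m) + gcoef (Suc m)) (geg (Suc m))"
proof (rule poly_ext_real)
  fix t
  show "poly (pderiv (geg (Suc (Suc m)))) t =
     poly (pderiv (geg m) + smult (real (Suc m) + gcoef (Suc m)) (geg (Suc m))) t"
    using geg_derivative_identities[of m t] geg_derivative_identities[of "Suc m" t]
    by (simp only: poly_add poly_smult of_nat_Suc) algebra
qed

text \<open>Obtained by differentiating \<open>geg_first_order\<close> and eliminating the
  polynomial of lower index.\<close>

lemma geg_ode:
  "[:1, 0, -1:] * pderiv (pderiv (geg m)) =
     smult (2 * lam + 1) ([:0, 1:] * pderiv (geg m)) - smult (real m * (real m + 2 * lam)) (geg m)"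
proof (cases m)
  case 0
  thus ?thesis by simp
next
  case (Suc k)
  show ?thesis
  proof (rule poly_ext_real)
    fix t
    have "poly (pderiv ([:1, 0, -1:] * pderiv (geg (Suc k)))) t =
        poly (pderiv (smult (gcoef k) (geg k) - smult (real k + 1) ([:0, 1:] * geg (Suc k)))) t"
      by (simp only: geg_first_order)
    hence "(1 - t * t) * poly (pderiv (pderiv (geg (Suc k)))) t - 2 * t * poly (pderiv (geg (Suc k))) t =
        gcoef k * poly (pderiv (geg k)) t
        - (real k + 1) * (poly (geg (Suc k)) t + t * poly (pderiv (geg (Suc k))) t)"
      by (simp del: geg.simps(3) add: pderiv_smult pderiv_diff pderiv_pCons pderiv_mult pderiv_minus pderiv_add algebra_simps)
    moreover have "gcoef k * poly (pderiv (geg k)) t = (real k + 2 * lam) * poly (pderiv (geg k)) t"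
      by (simp add: gcoef_def)
    ultimately show "poly ([:1, 0, -1:] * pderiv (pderiv (geg m))) t =
        poly (smult (2 * lam + 1) ([:0, 1:] * pderiv (geg m)) - smult (real m * (real m + 2 * lam)) (geg m)) t"
      using geg_derivative_identities[of k t] unfolding Suc
      by (simp only: poly_mult poly_diff poly_smult poly_pCons poly_0 of_nat_Suc) algebra
  qed
qed

text \<open>Weak form of the differential equation: \<open>wint_by_parts\<close> with
  \<open>q = pderiv (geg j) * geg k\<close>. The right-hand side is symmetric in \<open>j\<close>
  and \<open>k\<close>, which forces orthogonality.\<close>

lemma geg_eigen:
  "real j * (real j + 2 * lam) * wint (geg j * geg k) = wint ([:1, 0, -1:] * (pderiv (geg j) * pderiv (geg k)))"
proof -
  have "[:1, 0, -1:] * pderiv (pderiv (geg j) * geg k) - smult (2 * lam + 1) ([:0, 1:] * (pderiv (geg j) * geg k))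
      = [:1, 0, -1:] * (pderiv (geg j) * pderiv (geg k)) - smult (real j * (real j + 2 * lam)) (geg j * geg k)"
  proof (rule poly_ext_real)
    fix t
    show "poly ([:1, 0, -1:] * pderiv (pderiv (geg j) * geg k) - smult (2 * lam + 1) ([:0, 1:] * (pderiv (geg j) * geg k))) t
      = poly ([:1, 0, -1:] * (pderiv (geg j) * pderiv (geg k)) - smult (real j * (real j + 2 * lam)) (geg j * geg k)) t"
      using arg_cong[OF geg_ode[of j], of "\<lambda>p. poly p t"]
      by (simp only: pderiv_mult poly_add poly_mult poly_diff poly_smult poly_pCons poly_0) algebra
  qed
  thus ?thesis using wint_by_parts[of "pderiv (geg j) * geg k"]
    by (simp only: wint_diff wint_smult)
qed

lemma geg_orthogonal:
  assumes "j \<noteq> k"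
  shows "wint (geg j * geg k) = 0"
proof -
  have "real j * (real j + 2 * lam) * wint (geg j * geg k) = real k * (real k + 2 * lam) * wint (geg j * geg k)"
    using geg_eigen[of j k] geg_eigen[of k j] by (simp only: mult.commute)
  hence "(real j - real k) * (real j + real k + 2 * lam) * wint (geg j * geg k) = 0"
    by algebra
  \<comment> \<open>Hence \<open>j + k + 2 * lam > 0\<close>, so the eigenvalues of distinct indices
    differ.\<close>
  moreover have "real j + real k \<ge> 1"
    using assms by linarith
  ultimately show ?thesis using assms lam_gt by auto
qed

text \<open>The values \<open>grho m\<close> are the values of \<open>geg m\<close> at 1.\<close>

fun grho :: "nat \<Rightarrow> real" where
  "grho 0 = 1"
| "grho (Suc m) = gcoef m * grho m / real (Suc m)"

lemma gcoef_pos: "gcoef m > 0"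
  using lam_gt by (auto simp: gcoef_def intro: add_pos_nonneg) 

lemma grho_pos: "grho m > 0"
  by (induction m) (simp_all add: gcoef_pos)

text \<open>The square of the norm; \<open>gdnorm\<close> is likewise the squared norm of the
  derivative.\<close>

definition gnorm :: "nat \<Rightarrow> real" where
  "gnorm m = wint (geg m * geg m)"

lemma gnorm_0: "gnorm 0 = wint 1"
  by (simp add: gnorm_def)

lemma wint_geg_rec:
  "(real m + 2) * wint (geg (Suc (Suc m)) * p) =
     2 * (real m + 1 + lam) * wint ([:0, 1:] * (geg (Suc m) * p)) - gcoef m * wint (geg m * p)"
proof -
  have "smult (real m + 2) (geg (Suc (Suc m)) * p) =
      smult (2 * (real m + 1 + lam)) ([:0, 1:] * (geg (Suc m) * p)) - smult (gcoef m) (geg m * p)"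
  proof (rule poly_ext_real)
    fix t
    show "poly (smult (real m + 2) (geg (Suc (Suc m)) * p)) t =
        poly (smult (2 * (real m + 1 + lam)) ([:0, 1:] * (geg (Suc m) * p)) - smult (gcoef m) (geg m * p)) t"
      using poly_geg_rec[of m t]
      by (simp only: poly_mult poly_diff poly_smult poly_pCons poly_0) algebra
  qed
  thus ?thesis by (metis wint_diff wint_smult)
qed

lemma wint_X_geg:
  "2 * (real m + 1 + lam) * wint ([:0, 1:] * (geg (Suc m) * geg m)) = gcoef m * gnorm m"
  using wint_geg_rec[of m "geg m"] geg_orthogonal[of "Suc (Suc m)" m]
  by (simp only: gnorm_def)

text \<open>Pairing the recurrence with \<open>geg (Suc (Suc m))\<close> and using
  \<open>wint_X_geg\<close> gives a one-step recursion that \<open>grho\<close> solves. It starts at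
  index 1, since \<open>gnorm 0\<close> is \<open>wint 1\<close> whatever \<open>lam\<close>
  is.\<close>

lemma gnorm_Suc: "2 * (real m + 1 + lam) * gnorm (Suc m) = wint 1 * grho (Suc m)"
proof (induction m)
  case 0
  thus ?case using wint_X_geg[of 0] by (simp add: gnorm_def gcoef_def)
next
  case (Suc m)
  have "(real m + 2) * gnorm (Suc (Suc m)) =
      2 * (real m + 1 + lam) * wint ([:0, 1:] * (geg (Suc (Suc m)) * geg (Suc m)))"
    using wint_geg_rec[of m "geg (Suc (Suc m))"] geg_orthogonal[of m "Suc (Suc m)"]
    by (simp only: gnorm_def mult.commute[of "geg (Suc m)"])
  hence "(real m + 2) * (2 * (real (Suc m) + 1 + lam) * gnorm (Suc (Suc m))) =
      (2 * (real m + 1 + lam)) * (gcoef (Suc m) * gnorm (Suc m))"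
    using wint_X_geg[of "Suc m"] by algebra
  also have "\<dots> = gcoef (Suc m) * (wint 1 * grho (Suc m))"
    using Suc.IH by algebra
  also have "\<dots> = (real m + 2) * (wint 1 * grho (Suc (Suc m)))"
    by (subst grho.simps(2)[of "Suc m"]) (simp add: field_simps del: grho.simps)
  finally show ?case by (simp del: grho.simps add: add_nonneg_eq_0_iff)
qed

lemma gnorm_pos: "gnorm m > 0"
proof (cases m)
  case 0
  thus ?thesis by (simp add: gnorm_0 wint_1_pos)
next
  case (Suc k)
  have "2 * (real k + 1 + lam) * gnorm (Suc k) > 0"
    unfolding gnorm_Suc using wint_1_pos grho_pos by (rule mult_pos_pos)
  thus ?thesis using lam_gt Suc by (simp add: zero_less_mult_iff)
qed

section \<open>Expansion in the Gegenbauer basis\<close>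

lemma degree_geg_le: "degree (geg m) \<le> m"
proof (induction m rule: geg.induct)
  case (3 m)
  have "degree ([:0, 1:] * geg (Suc m)) \<le> Suc (Suc m)"
    using 3 by (intro order_trans[OF degree_mult_le]) auto
  thus ?case using 3
    by (auto intro!: order_trans[OF degree_smult_le] degree_diff_le simp del: mult_pCons_left)
qed auto

lemma coeff_geg_pos: "coeff (geg m) m > 0"
proof (induction m rule: geg.induct)
  case (3 m)
  have "coeff (geg m) (Suc (Suc m)) = 0"
    using degree_geg_le[of m] by (intro coeff_eq_0) auto
  thus ?case using 3 lam_gt by (auto intro!: mult_pos_pos divide_pos_pos)
qed auto

lemma geg_expansion:
  assumes "degree p \<le> n"
  shows "\<exists>x. p = (\<Sum>m\<le>n. smult (x m) (geg m))"
  using assms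
proof (induction n arbitrary: p)
  case 0
  then obtain c where "p = [:c:]" by (metis degree_eq_zeroE le_zero_eq)
  thus ?case by (intro exI[of _ "\<lambda>_. c"]) simp
next
  case (Suc n)
  define c where "c = coeff p (Suc n) / coeff (geg (Suc n)) (Suc n)"
  have "degree (p - smult c (geg (Suc n))) \<le> n"
  proof (rule degree_le, intro allI impI)
    fix i assume i: "n < i"
    show "coeff (p - smult c (geg (Suc n))) i = 0"
    proof (cases "i = Suc n")
      case True
      thus ?thesis using coeff_geg_pos[of "Suc n"] by (simp add: c_def del: geg.simps)
    next
      case False
      hence "coeff p i = 0" "coeff (geg (Suc n)) i = 0"
        using i Suc.prems degree_geg_le[of "Suc n"] by (auto intro!: coeff_eq_0 simp del: geg.simps)
      thus ?thesis by simp
    qed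
  qed
  then obtain x where "p - smult c (geg (Suc n)) = (\<Sum>m\<le>n. smult (x m) (geg m))"
    using Suc.IH by blast
  hence "p = (\<Sum>m\<le>n. smult (x m) (geg m)) + smult c (geg (Suc n))"
    by (metis diff_add_cancel)
  also have "\<dots> = (\<Sum>m\<le>Suc n. smult ((x(Suc n := c)) m) (geg m))"
    by (simp del: geg.simps)
  finally show ?case by blast
qed

end

section \<open>The Gram matrix of the derivatives\<close>

text \<open>Bordering a matrix by a new last index: the minimum of that index with an old one is the
  old one, so the row and the column contribute the same single sum.\<close>

lemma sum_atMost_Suc_min:
  fixes f g :: "nat \<Rightarrow> real"
  shows "(\<Sum>l\<le>Suc i. \<Sum>l'\<le>Suc i. f l * f l' * g (min l l')) =
    (\<Sum>l\<le>i. \<Sum>l'\<le>i. f l * f l' * g (min l l'))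
    + f (Suc i) * (2 * (\<Sum>l\<le>i. f l * g l) + f (Suc i) * g (Suc i))"
proof -
  have "(\<Sum>l\<le>i. f l * f (Suc i) * g (min l (Suc i))) = f (Suc i) * (\<Sum>l\<le>i. f l * g l)"
    and "(\<Sum>l\<le>i. f (Suc i) * f l * g (min (Suc i) l)) = f (Suc i) * (\<Sum>l\<le>i. f l * g l)"
    by (simp_all add: sum_distrib_left mult_ac min_def)
  thus ?thesis by (simp add: sum.distrib algebra_simps)
qed

context gegenbauer
begin

definition gidx :: "nat \<Rightarrow> nat set" where
  "gidx m = {k. k < m \<and> odd (m + k)}"

lemma finite_gidx: "finite (gidx m)"
  by (simp add: gidx_def)

lemma gidx_0: "gidx 0 = {}" and gidx_1: "gidx (Suc 0) = {0}"
  by (auto simp: gidx_def)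

lemma gidx_Suc_Suc: "gidx (Suc (Suc m)) = insert (Suc m) (gidx m)" "Suc m \<notin> gidx m"
  by (auto simp: gidx_def less_Suc_eq)

text \<open>Index sets of equal parity are nested and those of opposite parity disjoint; hence the
  two blocks of the Gram matrix and the dependence of their entries on the smaller index.\<close>

lemma gidx_Int:
  "gidx m \<inter> gidx k = (if even (m + k) then gidx (min m k) else {})"
  by (auto simp: gidx_def min_def)

definition gfac :: "nat \<Rightarrow> real" where
  "gfac k = real k + gcoef k"

lemma pderiv_geg: "pderiv (geg m) = (\<Sum>k\<in>gidx m. smult (gfac k) (geg k))"
proof (induction m rule: geg.induct)
  case 1 show ?case by (simp add: gidx_0)
next
  case 2 show ?case by (simp add: gidx_1 gfac_def gcoef_def pderiv_pCons one_pCons)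
next
  case (3 m)
  show ?case unfolding pderiv_geg_step 3(2) gidx_Suc_Suc(1)
    by (subst sum.insert) (simp_all del: geg.simps add: finite_gidx gidx_Suc_Suc(2) gfac_def add.commute)
qed

lemma wint_geg_sums:
  assumes "finite A" "finite B"
  shows "wint ((\<Sum>k\<in>A. smult (x k) (geg k)) * (\<Sum>k\<in>B. smult (y k) (geg k))) =
    (\<Sum>k\<in>A \<inter> B. x k * y k * gnorm k)"
proof -
  have "wint ((\<Sum>k\<in>A. smult (x k) (geg k)) * (\<Sum>k\<in>B. smult (y k) (geg k))) =
      (\<Sum>j\<in>A. \<Sum>k\<in>B. x j * y k * wint (geg j * geg k))"
    by (simp add: sum_product wint_sum wint_smult mult_ac)
  also have "\<dots> = (\<Sum>j\<in>A. \<Sum>k\<in>B. if k = j then x j * y j * gnorm j else 0)"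
    by (intro sum.cong) (auto simp: geg_orthogonal gnorm_def)
  also have "\<dots> = (\<Sum>j\<in>A. if j \<in> B then x j * y j * gnorm j else 0)"
    using assms by simp
  also have "\<dots> = (\<Sum>k\<in>A \<inter> B. x k * y k * gnorm k)"
    using assms by (simp add: sum.inter_restrict)
  finally show ?thesis .
qed

definition gdnorm :: "nat \<Rightarrow> real" where
  "gdnorm m = wint (pderiv (geg m) * pderiv (geg m))"

lemma gdnorm_sum: "gdnorm m = (\<Sum>k\<in>gidx m. gfac k * gfac k * gnorm k)"
  unfolding gdnorm_def pderiv_geg by (subst wint_geg_sums) (auto simp: finite_gidx)

lemma wint_pderiv_geg:
  "wint (pderiv (geg m) * pderiv (geg k)) = (if even (m + k) then gdnorm (min m k) else 0)"
  unfolding gdnorm_sum unfolding pderiv_geg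
  by (subst wint_geg_sums) (auto simp: finite_gidx gidx_Int)

text \<open>The factor \<open>m\<close> on both sides absorbs the exceptional value of
  \<open>gcoef\<close> at 0.\<close>

lemma grho_mult_index: "real m * (real m + 2 * lam) * grho m = real m * (real m + 1) * grho (Suc m)"
  by (cases "m = 0") (simp_all add: gcoef_def del: of_nat_Suc, simp add: field_simps)

lemma grho_Suc_Suc: "(real m + 2) * grho (Suc (Suc m)) = (real m + 1 + 2 * lam) * grho (Suc m)"
  by (subst grho.simps(2)) (simp add: gcoef_def field_simps del: grho.simps)

text \<open>The sum in \<open>gdnorm_sum\<close> telescopes: passing from \<open>m\<close> to
  \<open>m + 2\<close> adds \<open>2 * (m + 1 + lam) * wint 1 * grho (Suc m)\<close>, which is the
  increment of the closed form.\<close>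

lemma gdnorm_eq:
  "(2 * lam + 1) * gdnorm m = wint 1 * grho m * (real m * (real m + 2 * lam))"
proof (induction m rule: geg.induct)
  case 1 show ?case by (simp add: gdnorm_sum gidx_0)
next
  case 2 show ?case by (simp add: gdnorm_sum gidx_1 gfac_def gcoef_def gnorm_0)
next
  case (3 m)
  have fac: "gfac (Suc m) = 2 * (real m + 1 + lam)"
    by (simp add: gfac_def gcoef_def)
  have "gdnorm (Suc (Suc m)) = gdnorm m + gfac (Suc m) * gfac (Suc m) * gnorm (Suc m)"
    unfolding gdnorm_sum gidx_Suc_Suc(1)
    by (subst sum.insert) (simp_all add: finite_gidx gidx_Suc_Suc(2))
  hence "gdnorm (Suc (Suc m)) = gdnorm m + 2 * (real m + 1 + lam) * (wint 1 * grho (Suc m))"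
    using gnorm_Suc[of m] unfolding fac by algebra
  moreover have "real (Suc (Suc m)) = real m + 2" by simp
  ultimately show ?case
    using 3(2) grho_mult_index[of m] grho_Suc_Suc[of m] by algebra
qed

text \<open>The diagonal entries of the normalised Gram matrix; \<open>wint 1\<close> and
  \<open>grho m\<close> cancel, which leaves a polynomial in \<open>m\<close>.\<close>

lemma gdnorm_over_gnorm:
  "gdnorm m / gnorm m = 2 * (real m + lam) * (real m * (real m + 2 * lam)) / (2 * lam + 1)"
proof (cases m)
  case 0
  thus ?thesis by (simp add: gdnorm_sum gidx_0)
next
  case (Suc k)
  have "real m = real k + 1" by (simp add: Suc)
  hence "(2 * lam + 1) * gdnorm m = gnorm m * (2 * (real m + lam) * (real m * (real m + 2 * lam)))"
    using gdnorm_eq[of m] gnorm_Suc[of k] unfolding Suc by algebra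
  thus ?thesis using lam_gt gnorm_pos[of m] by (simp add: field_simps)
qed

text \<open>
  A discrete antiderivative (in steps of 2) of \<open>(gdnorm j)\<^sup>2 / gnorm j\<close>, found by an ansatz with an
  undetermined affine function of \<open>(j + lam + 1)\<^sup>2\<close> as a factor.
\<close>

definition gpart :: "nat \<Rightarrow> real" where
  "gpart j = wint 1 * grho j * (real j * (real j + 2 * lam)) * (real j + 2 * lam + 1) * (real j + 2 * lam + 2)
     * ((2 * lam + 3) * (real j + lam + 1)^2 - (2 * lam^3 + 7 * lam^2 + 8 * lam + 7))
     / ((2 * lam + 1)^2 * (2 * lam + 5) * (2 * lam + 3))"

lemma gdnorm_sq_over_gnorm:
  "(2 * lam + 1)^2 * ((gdnorm m)\<^sup>2 / gnorm m) =
     2 * (real m + lam) * (real m * (real m + 2 * lam))^2 * wint 1 * grho m"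
proof -
  have "(gdnorm m)\<^sup>2 / gnorm m = gdnorm m * (gdnorm m / gnorm m)"
    by (simp add: power2_eq_square)
  hence "(2 * lam + 1)^2 * ((gdnorm m)\<^sup>2 / gnorm m) = 
      ((2 * lam + 1) * gdnorm m) * ((2 * lam + 1) * (gdnorm m / gnorm m))"
    by (simp only: power2_eq_square mult_ac)
  also have "(2 * lam + 1) * (gdnorm m / gnorm m) = 2 * (real m + lam) * (real m * (real m + 2 * lam))"
    using lam_gt by (simp add: gdnorm_over_gnorm)
  finally show ?thesis unfolding gdnorm_eq by (simp add: power2_eq_square mult_ac)
qed

lemma gpart_eq:
  "(2 * lam + 1)^2 * ((2 * lam + 5) * (2 * lam + 3) * gpart j) =
   wint 1 * grho j * (real j * (real j + 2 * lam)) * (real j + 2 * lam + 1) * (real j + 2 * lam + 2)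
     * ((2 * lam + 3) * (real j + lam + 1)^2 - (2 * lam^3 + 7 * lam^2 + 8 * lam + 7))"
  using lam_gt by (simp add: gpart_def)

lemma gpart_step: "gpart (Suc (Suc j)) = gpart j + (gdnorm (Suc (Suc j)))\<^sup>2 / gnorm (Suc (Suc j))"
proof -
  define y R where "y = real j" "R = grho (Suc (Suc j))"
  define D where "D = (gdnorm (Suc (Suc j)))\<^sup>2 / gnorm (Suc (Suc j))"
  have 1: "real (Suc (Suc j)) = y + 2" by (simp add: y_R_def)
  \<comment> \<open>Expressing \<open>grho j\<close> through \<open>R\<close> turns the claim,
    cleared of denominators, into a polynomial identity in \<open>y\<close> and
    \<open>lam\<close>.\<close>
  have 2: "grho j * (y * (y + 2 * lam)) * (y + 2 * lam + 1) = y * (y + 1) * (y + 2) * R"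
    using grho_mult_index[of j] grho_Suc_Suc[of j] unfolding y_R_def by algebra
  have "(2 * lam + 1)^2 * ((2 * lam + 5) * (2 * lam + 3) * (gpart (Suc (Suc j)) - gpart j - D)) =
    (2 * lam + 1)^2 * ((2 * lam + 5) * (2 * lam + 3) * gpart (Suc (Suc j)))
    - (2 * lam + 1)^2 * ((2 * lam + 5) * (2 * lam + 3) * gpart j)
    - (2 * lam + 5) * (2 * lam + 3) * ((2 * lam + 1)^2 * D)"
    by algebra
  also have "\<dots> = 0"
    unfolding gpart_eq gdnorm_sq_over_gnorm D_def 1
    unfolding y_R_def[symmetric] using 2 by algebra
  finally show ?thesis using lam_gt by (simp add: D_def)
qed

lemma sum_gdnorm_sq:
  assumes "r < 2"
  shows "(\<Sum>l\<le>i. (gdnorm (2 * l + r))\<^sup>2 / gnorm (2 * l + r)) = gpart (2 * i + r)"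
proof (induction i)
  case 0
  \<comment> \<open>The constant of summation is zero: \<open>gpart 0\<close> and
    \<open>gdnorm 0\<close> vanish, and at index 1 both sides agree.\<close>
  have "(gdnorm 1)\<^sup>2 / gnorm 1 = gpart 1"
  proof -
    have "(2 * lam + 1)^2 * ((2 * lam + 5) * (2 * lam + 3) * (gpart 1 - (gdnorm 1)\<^sup>2 / gnorm 1)) =
      (2 * lam + 1)^2 * ((2 * lam + 5) * (2 * lam + 3) * gpart 1)
      - (2 * lam + 5) * (2 * lam + 3) * ((2 * lam + 1)^2 * ((gdnorm 1)\<^sup>2 / gnorm 1))"
      by algebra
    also have "\<dots> = 0"
      unfolding gpart_eq gdnorm_sq_over_gnorm of_nat_1 by algebra
    finally show ?thesis using lam_gt by simp
  qed
  moreover have "r = 0 \<or> r = 1" using assms by auto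
  ultimately show ?case by (auto simp: gdnorm_sum gidx_0 gpart_def)
next
  case (Suc i)
  thus ?case using gpart_step[of "2 * i + r"] by simp
qed

text \<open>The increment of the squared Frobenius norm \<open>gT\<close> when the index \<open>j\<close> is added.\<close>

definition gQ :: "nat \<Rightarrow> real" where
  "gQ j = 4 * (real j + lam) * (real j * (real j + 2 * lam))
     * ((2 * lam + 3) * (real j * (real j + 2 * lam))^2
        + (4 * lam^3 + 16 * lam^2 + 31 * lam + 20) * (real j * (real j + 2 * lam))
        - 8 * (2 * lam + 1) * (lam + 1))
     / ((2 * lam + 1)^2 * (2 * lam + 5) * (2 * lam + 3))"

text \<open>The squared entries of the new row and of the new column each sum to
  \<open>gpart j / gnorm j\<close>, and the shared diagonal one is subtracted once. Dividing by
  \<open>gnorm j\<close> cancels \<open>grho j\<close>, so the increment is a polynomial.\<close>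

lemma gQ_eq: "gQ j = (2 * gpart j - (gdnorm j)\<^sup>2 / gnorm j) / gnorm j"
proof (cases j)
  case 0
  thus ?thesis by (simp add: gQ_def gpart_def gdnorm_sum gidx_0)
next
  case (Suc k)
  define y D W where "y = real j" "D = (gdnorm j)\<^sup>2 / gnorm j" "W = wint 1 * grho j"
  note defs = y_D_W_def
  have "y = real k + 1" by (simp add: Suc defs)
  hence W: "W = 2 * (y + lam) * gnorm j"
    using gnorm_Suc[of k] by (simp add: Suc defs mult_ac add_ac del: grho.simps)
  have "(2 * lam + 1)^2 * ((2 * lam + 5) * (2 * lam + 3) * (2 * gpart j - D)) =
    2 * ((2 * lam + 1)^2 * ((2 * lam + 5) * (2 * lam + 3) * gpart j))
    - (2 * lam + 5) * (2 * lam + 3) * ((2 * lam + 1)^2 * D)"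
    by algebra
  also have "\<dots> = ((2 * lam + 1)^2 * (2 * lam + 5) * (2 * lam + 3)) * (gQ j * gnorm j)"
  proof -
    have "((2 * lam + 1)^2 * (2 * lam + 5) * (2 * lam + 3)) * gQ j = 4 * (y + lam) * (y * (y + 2 * lam))
     * ((2 * lam + 3) * (y * (y + 2 * lam))^2
        + (4 * lam^3 + 16 * lam^2 + 31 * lam + 20) * (y * (y + 2 * lam))
        - 8 * (2 * lam + 1) * (lam + 1))"
      using lam_gt by (simp add: gQ_def defs)
    moreover have "2 * ((2 * lam + 1)^2 * ((2 * lam + 5) * (2 * lam + 3) * gpart j)) = 
       2 * (W * (y * (y + 2 * lam)) * (y + 2 * lam + 1) * (y + 2 * lam + 2)
     * ((2 * lam + 3) * (y + lam + 1)^2 - (2 * lam^3 + 7 * lam^2 + 8 * lam + 7)))"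
      unfolding gpart_eq defs ..
    moreover have "(2 * lam + 1)^2 * D = 2 * (y + lam) * (y * (y + 2 * lam))^2 * W"
      unfolding defs gdnorm_sq_over_gnorm by (simp only: mult_ac)
    ultimately show ?thesis using W by algebra
  qed
  finally have "2 * gpart j - D = gQ j * gnorm j" using lam_gt by simp
  thus ?thesis using gnorm_pos[of j] by (simp add: defs)
qed

text \<open>The squared Frobenius norm of the block of parity \<open>r\<close>, whose normalised
  entries are \<open>gdnorm (2 * min l l' + r) / sqrt (gnorm (2 * l + r) * gnorm (2 * l' +
  r))\<close>.\<close>

definition gT :: "nat \<Rightarrow> nat \<Rightarrow> real" where
  "gT r i = (\<Sum>l\<le>i. \<Sum>l'\<le>i. (gdnorm (2 * min l l' + r))\<^sup>2 / (gnorm (2 * l + r) * gnorm (2 * l' + r)))"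

lemma gT_eq:
  assumes "r < 2"
  shows "gT r i = (\<Sum>l\<le>i. gQ (2 * l + r))"
proof (induction i)
  case 0
  have "gpart r = (gdnorm r)\<^sup>2 / gnorm r" using sum_gdnorm_sq[OF assms, of 0] by simp
  thus ?case by (simp add: gT_def gQ_eq)
next
  case (Suc i)
  define f where "f = (\<lambda>l. 1 / gnorm (2 * l + r))"
  define g where "g = (\<lambda>l. (gdnorm (2 * l + r))\<^sup>2)"
  have T: "gT r k = (\<Sum>l\<le>k. \<Sum>l'\<le>k. f l * f l' * g (min l l'))" for k
    by (simp add: gT_def f_def g_def mult.commute)
  have V: "(\<Sum>l\<le>k. f l * g l) = gpart (2 * k + r)" for k
    using sum_gdnorm_sq[OF assms, of k] by (simp add: f_def g_def)
  have "gT r (Suc i) = gT r i + f (Suc i) * (2 * gpart (2 * i + r) + f (Suc i) * g (Suc i))"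
    unfolding T sum_atMost_Suc_min V ..
  also have "2 * gpart (2 * i + r) + f (Suc i) * g (Suc i) = 2 * gpart (2 * Suc i + r) - f (Suc i) * g (Suc i)"
    using gpart_step[of "2 * i + r"] by (simp add: f_def g_def)
  also have "f (Suc i) * \<dots> = gQ (2 * Suc i + r)"
    unfolding gQ_eq by (simp add: f_def g_def)
  finally show ?case using Suc.IH by simp
qed

end

section \<open>Closed forms of the traces\<close>

text \<open>
  Up to a constant factor, \<open>tr B\<^sup>2\<close> as a polynomial in \<open>N = (n + 1) * (n + 2 * lam + 1)\<close>.
\<close>

definition trace_poly :: "real \<Rightarrow> real \<Rightarrow> real" where
  "trace_poly l N = 3 * (2*l+3) * N^4 + 4 * (4*l^3 + 16*l^2 + 17*l - 1) * N^3
     - 2 * (64*l^3 + 244*l^2 + 284*l + 77) * N^2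
     + 4 * (- 16*l^5 - 64*l^4 - 40*l^3 + 164*l^2 + 227*l + 71) * N"

text \<open>The inequality \<open>tr B\<^sup>2 \<ge> c * tr B\<close> cleared of denominators, with
  \<open>c\<close> the claimed lower bound: \<open>N * (N - 2)\<close> stems from
  \<open>tr B\<close> and \<open>N * (y+l+1/2)^2\<close> from \<open>c\<close>.\<close>

lemma trace_poly_lower:
  fixes l y :: real
  assumes "l > -1/2" "y \<ge> 3"
  defines "N \<equiv> (y+1) * (y+2*l+1)"
  shows "3 * (2*l+3) * (N^2 * (N-2)) * (y+l+1/2)^2 \<le> trace_poly l N"
proof -
  \<comment> \<open>In the shifted variables all coefficients of the difference are positive.\<close>
  define m b where "m = y - 3" "b = l + 1/2"
  have mb: "m \<ge> 0" "b \<ge> 0" using assms by (auto simp: m_b_def)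
  have ly: "y = m + 3" "l = b - 1/2" by (auto simp: m_b_def)
  define P where "P = 6 * m^5 * b + 6 * m^5 + 10 * m^4 * b^3 + 70 * m^4 * b^2
    + 166 * m^4 * b + 90 * m^4 + 40 * m^3 * b^4 + 348 * m^3 * b^3 + 1164 * m^3 * b^2
    + 1526 * m^3 * b + 510 * m^3 + 40 * m^2 * b^5 + 624 * m^2 * b^4 + 3062 * m^2 * b^3
    + 6754 * m^2 * b^2 + 6122 * m^2 * b + 1350 * m^2 + 320 * m * b^5 + 2840 * m * b^4
    + 9852 * m * b^3 + 16012 * m * b^2 + 10804 * m * b + 1644 * m + 576 * b^5 + 3840 * b^4
    + 10320 * b^3 + 13152 * b^2 + 6816 * b + 720"
  have "N \<ge> 0" unfolding N_def using assms by (intro mult_nonneg_nonneg) auto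
  moreover have "P \<ge> 0" unfolding P_def
    by (intro add_nonneg_nonneg mult_nonneg_nonneg zero_le_power mb) auto
  ultimately have "N * P \<ge> 0" by (rule mult_nonneg_nonneg)
  moreover have "trace_poly l N - 3 * (2*l+3) * (N^2 * (N-2)) * (y+l+1/2)^2 = N * P"
    unfolding trace_poly_def P_def N_def ly by (simp add: field_simps) algebra
  ultimately show ?thesis by linarith
qed

text \<open>After the substitution \<open>y = m + 3\<close> the difference is \<open>N\<close> times
  a polynomial whose coefficients in \<open>m\<close> and \<open>l\<close> are all positive.\<close>

lemma trace_poly_upper_nonneg:
  fixes l y :: real
  assumes "l \<ge> 0" "y \<ge> 3"
  shows "trace_poly l ((y+1) * (y+2*l+1)) \<le> 3 * (2*l+3) * ((y+1)^3 * (y+2*l+1)^5)"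
proof -
  define m where "m = y - 3"
  have m: "m \<ge> 0" "y = m + 3" using assms by (auto simp: m_def)
  define P where "P = 12 * m^5 * l^2 + 18 * m^5 * l + 56 * m^4 * l^3 + 284 * m^4 * l^2
    + 292 * m^4 * l + 4 * m^4 + 80 * m^3 * l^4 + 856 * m^3 * l^3 + 2352 * m^3 * l^2
    + 1808 * m^3 * l + 64 * m^3 + 32 * m^2 * l^5 + 848 * m^2 * l^4 + 4752 * m^2 * l^3
    + 9144 * m^2 * l^2 + 5752 * m^2 * l + 538 * m^2 + 256 * m * l^5 + 3200 * m * l^4
    + 12240 * m * l^3 + 18736 * m * l^2 + 11252 * m * l + 2256 * m + 576 * l^5 + 4608 * l^4
    + 13536 * l^3 + 18096 * l^2 + 11460 * l + 3204"
  have "(y+1) * (y+2*l+1) \<ge> 0" using assms by (intro mult_nonneg_nonneg) auto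
  moreover have "P \<ge> 0" unfolding P_def
    by (intro add_nonneg_nonneg mult_nonneg_nonneg zero_le_power m assms) auto
  ultimately have "(y+1) * (y+2*l+1) * P \<ge> 0" by (rule mult_nonneg_nonneg)
  moreover have "3 * (2*l+3) * ((y+1)^3 * (y+2*l+1)^5) - trace_poly l ((y+1) * (y+2*l+1)) = (y+1) * (y+2*l+1) * P"
    unfolding trace_poly_def P_def m(2) by algebra
  ultimately show ?thesis by linarith
qed

text \<open>For \<open>l \<le> 0\<close> the upper bound is a multiple of \<open>N^4\<close>, since
  \<open>max l 0 = 0\<close>. The difference is \<open>N * ((a * N + b) * N - c)\<close>, whose
  second factor is least at \<open>N = 12\<close>, the bound \<open>4 * 3\<close> that
  \<open>y \<ge> 3\<close> and \<open>l > -1/2\<close> guarantee.\<close>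

lemma trace_poly_upper_neg:
  fixes l N :: real
  assumes "-1/2 < l" "l \<le> 0" "N \<ge> 12"
  shows "trace_poly l N \<le> 3 * (2*l+3) * N^4"
proof -
  define z where "z = - l"
  have z: "0 \<le> z" "z \<le> 1/2" "l = - z" using assms by (auto simp: z_def)
  define a b c where "a = 4 * (4*z^3 - 16*z^2 + 17*z + 1)" "b = 2 * (- 64*z^3 + 244*z^2 - 284*z + 77)"
    "c = 4 * (16*z^5 - 64*z^4 + 40*z^3 + 164*z^2 - 227*z + 71)"
  \<comment> \<open>As \<open>z \<le> 1/2\<close>, powers are bounded by half the preceding ones,
    which reduces the three sign conditions to linear arithmetic in the powers of
    \<open>z\<close>.\<close>
  have sq: "z^2 \<le> z/2" "0 \<le> z^2" using mult_left_mono[of z "1/2" z] z by (auto simp: power2_eq_square)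
  have cu: "z^3 \<le> z^2/2" "0 \<le> z^3"
    using mult_left_mono[of z "1/2" "z^2"] z by (auto simp: power2_eq_square power3_eq_cube)
  have qu: "z^4 \<ge> 0" "z^5 \<le> z^4/2"
    using mult_left_mono[of z "1/2" "z^4"] z by (auto simp: power_numeral_reduce algebra_simps)
  have A: "a \<ge> 0" unfolding a_b_c_def using sq cu qu z by argo
  have AB: "12 * a + b \<ge> 0" unfolding a_b_c_def using sq cu qu z by argo
  have ABC: "144 * a + 12 * b \<ge> c" unfolding a_b_c_def using sq cu qu z by argo
  have "3 * (2*l+3) * N^4 - trace_poly l N = N * ((a * N + b) * N - c)"
    unfolding trace_poly_def a_b_c_def z(3) by algebra
  moreover have "a * 12 + b \<le> a * N + b" using A assms by (simp add: mult_left_mono)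
  hence "(a * 12 + b) * 12 \<le> (a * N + b) * N" using AB assms by (intro mult_mono) auto
  hence "(a * N + b) * N - c \<ge> 0" using ABC by argo
  hence "N * ((a * N + b) * N - c) \<ge> 0" using assms by (intro mult_nonneg_nonneg) auto
  ultimately show ?thesis by linarith
qed

lemma trace_poly_upper:
  fixes l y :: real
  assumes "-1/2 < l" "y \<ge> 3"
  shows "trace_poly l ((y+1) * (y+2*l+1)) \<le> 3 * (2*l+3) * ((y+1)^3 * (y+2*l+1)^4 * (y + 2 * max l 0 + 1))"
proof (cases "l \<ge> 0")
  case True
  thus ?thesis using trace_poly_upper_nonneg[OF True assms(2)]
    by (simp add: power_numeral_reduce mult_ac)
next
  case False
  have "4 * 3 \<le> (y+1) * (y+2*l+1)" using assms by (intro mult_mono) auto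
  moreover have "((y+1) * (y+2*l+1))^4 = (y+1)^3 * (y+2*l+1)^4 * (y + 2 * max l 0 + 1)"
    using False by (simp add: max_def) algebra
  ultimately show ?thesis using trace_poly_upper_neg[of l "(y+1) * (y+2*l+1)"] assms False
    by simp
qed

section \<open>Traces of the odd block and comparison with the even block\<close>

context gegenbauer
begin

lemma sum_gQ_odd:
  "12 * ((2 * lam + 1)^2 * (2 * lam + 5) * (2 * lam + 3)) * (\<Sum>l\<le>i. gQ (2 * l + 1)) =
     trace_poly lam ((2 * real i + 2) * (2 * real i + 2 * lam + 2))"
proof -
  have Q: "12 * ((2 * lam + 1)^2 * (2 * lam + 5) * (2 * lam + 3)) * gQ j =
     48 * (real j + lam) * (real j * (real j + 2 * lam))
     * ((2 * lam + 3) * (real j * (real j + 2 * lam))^2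
        + (4 * lam^3 + 16 * lam^2 + 31 * lam + 20) * (real j * (real j + 2 * lam))
        - 8 * (2 * lam + 1) * (lam + 1))" for j
    using lam_gt by (simp add: gQ_def)
  show ?thesis
  proof (induction i)
    case 0
    have sum_0: "(\<Sum>l\<le>0. gQ (2 * l + 1)) = gQ 1" by simp
    show ?case unfolding sum_0 Q trace_poly_def of_nat_0 of_nat_1 by algebra
  next
    case (Suc i)
    have j: "real (2 * Suc i + 1) = 2 * real i + 3" "real (Suc i) = real i + 1" by simp_all
    show ?case
      unfolding sum.atMost_Suc distrib_left[of "12 * ((2 * lam + 1)^2 * (2 * lam + 5) * (2 * lam + 3))"]
        Suc.IH Q j trace_poly_def by algebra
  qed
qed

lemma sum_gdnorm_over_gnorm_odd:
  fixes i :: nat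
  defines "N \<equiv> (2 * real i + 2) * (2 * real i + 2 * lam + 2)"
  shows "4 * (2 * lam + 1) * (\<Sum>l\<le>i. gdnorm (2 * l + 1) / gnorm (2 * l + 1)) = N * (N - 2)"
proof -
  have Q: "4 * (2 * lam + 1) * (gdnorm j / gnorm j) =
     8 * (real j + lam) * (real j * (real j + 2 * lam))" for j
  proof -
    have "(2 * lam + 1) * (gdnorm j / gnorm j) = 2 * (real j + lam) * (real j * (real j + 2 * lam))"
      using lam_gt by (simp add: gdnorm_over_gnorm)
    thus ?thesis by algebra
  qed
  show ?thesis unfolding N_def
  proof (induction i)
    case 0
    have sum_0: "(\<Sum>l\<le>0. gdnorm (2 * l + 1) / gnorm (2 * l + 1)) = gdnorm 1 / gnorm 1" by simp
    show ?case unfolding sum_0 Q of_nat_0 of_nat_1 by algebra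
  next
    case (Suc i)
    have j: "real (2 * Suc i + 1) = 2 * real i + 3" "real (Suc i) = real i + 1" by simp_all
    show ?case
      unfolding sum.atMost_Suc distrib_left[of "4 * (2 * lam + 1)"] Suc.IH Q j by algebra
  qed
qed

text \<open>For \<open>j \<ge> 1\<close> each of the factors \<open>j + lam\<close>,
  \<open>X j\<close> and \<open>br (X j)\<close> is nonnegative and increasing in \<open>j\<close>.
  Index 0 is treated apart, \<open>br 0\<close> being negative.\<close>

lemma gQ_mono:
  assumes "j \<le> k"
  shows "0 \<le> gQ j" "gQ j \<le> gQ k"
proof -
  define X where "X = (\<lambda>j. real j * (real j + 2 * lam))"
  define br where "br = (\<lambda>x. (2 * lam + 3) * x^2 + (4 * lam^3 + 16 * lam^2 + 31 * lam + 20) * x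
        - 8 * (2 * lam + 1) * (lam + 1))"
  define K where "K = (2 * lam + 1)^2 * (2 * lam + 5) * (2 * lam + 3)"
  have K: "K > 0" using lam_gt by (auto simp: K_def)
  have gQ: "gQ j = (4 * (real j + lam) * X j) * br (X j) / K" for j
    by (simp add: gQ_def X_def br_def K_def)
  define s where "s = lam + 1/2"
  have s: "s > 0" "lam = s - 1/2" using lam_gt by (auto simp: s_def)
  have e: "4 * lam^3 + 16 * lam^2 + 31 * lam + 20 \<ge> 0"
  proof -
    have "4 * lam^3 + 16 * lam^2 + 31 * lam + 20 = 4 * s^3 + 10 * s^2 + 18 * s + 8"
      unfolding s(2) by (simp add: power2_eq_square power3_eq_cube algebra_simps)
    moreover have "4 * s^3 + 10 * s^2 + 18 * s + 8 \<ge> 0" using s by simp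
    ultimately show ?thesis by linarith
  qed
  have br_mono: "br x \<le> br z" if "0 \<le> x" "x \<le> z" for x z
    unfolding br_def using that e lam_gt
    by (intro diff_right_mono add_mono mult_left_mono power_mono) auto
  \<comment> \<open>\<open>2 * lam + 1\<close> is \<open>X 1\<close>, the least value of
    \<open>X\<close> at positive indices.\<close>
  have "br (2 * lam + 1) = (2 * lam + 1) * (lam + 1) * (2 * lam + 3) * (2 * lam + 5)"
    unfolding br_def by algebra
  hence br1: "br (2 * lam + 1) \<ge> 0" using lam_gt by simp
  have main: "0 \<le> gQ j \<and> gQ j \<le> gQ k" if jk: "1 \<le> j" "j \<le> k" for j k
  proof -
    have "real j \<ge> 1" "real k \<ge> real j" using jk by auto
    hence X1: "2 * lam + 1 \<le> X j" and X2: "X j \<le> X k"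
      unfolding X_def using lam_gt mult_mono[of 1 "real j" "2 * lam + 1" "real j + 2 * lam"]
      by (auto intro!: mult_mono)
    have b: "0 \<le> br (X j)" "br (X j) \<le> br (X k)"
      using br_mono[OF _ X1] br1 br_mono[OF _ X2] X1 lam_gt by auto
    have c: "0 \<le> 4 * (real j + lam) * X j" "4 * (real j + lam) * X j \<le> 4 * (real k + lam) * X k"
      using X1 X2 lam_gt \<open>real j \<ge> 1\<close> \<open>real k \<ge> real j\<close> by (auto intro!: mult_nonneg_nonneg mult_mono)
    have "0 \<le> (4 * (real j + lam) * X j) * br (X j)"
      using c(1) b(1) by (rule mult_nonneg_nonneg)
    moreover have "(4 * (real j + lam) * X j) * br (X j) \<le> (4 * (real k + lam) * X k) * br (X k)"
      by (rule mult_mono[OF c(2) b(2)]) (use b c in linarith)+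
    ultimately show ?thesis using K unfolding gQ
      by (meson divide_right_mono divide_nonneg_pos less_imp_le)
  qed
  have z: "gQ 0 = 0" by (simp add: gQ_def)
  have nn: "0 \<le> gQ k" for k using main[of k k] z by (cases "k = 0") auto
  show "0 \<le> gQ j" by (rule nn)
  show "gQ j \<le> gQ k" using main[of j k] assms z nn[of k] by (cases "j = 0") auto
qed

text \<open>For odd \<open>n\<close> both blocks have \<open>i + 1\<close> indices, and the
  increments are compared in pairs \<open>2 * l \<le> 2 * l + 1\<close>.\<close>

lemma gT_even_le_odd: "gT 0 i \<le> gT 1 i"
  using gT_eq[of 0 i] gT_eq[of 1 i] by (simp add: sum_mono gQ_mono)

lemma gT_nonneg: "gT r i \<ge> 0"
  unfolding gT_def by (intro sum_nonneg divide_nonneg_pos mult_pos_pos gnorm_pos) auto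

end

section \<open>Bounds for the Markov constant\<close>

lemma sum_split_parity:
  fixes f :: "nat \<Rightarrow> 'a::comm_monoid_add"
  shows "(\<Sum>m\<le>2 * i + 1. f m) = (\<Sum>l\<le>i. f (2 * l + 0)) + (\<Sum>l\<le>i. f (2 * l + 1))"
  by (induction i) (simp_all add: numeral_2_eq_2 ac_simps)

lemma pderiv_sum: "pderiv (\<Sum>i\<in>A. f i) = (\<Sum>i\<in>A. pderiv (f i))"
  using higher_pderiv_sum[of 1 f A] by simp

context gegenbauer
begin

lemma wint_sum_sum:
  "wint ((\<Sum>l\<in>A. smult (c l) (f l)) * (\<Sum>l\<in>B. smult (d l) (g l))) =
    (\<Sum>l\<in>A. \<Sum>l'\<in>B. c l * d l' * wint (f l * g l'))"
  by (simp add: sum_product wint_sum wint_smult mult_ac)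

definition par_sum :: "nat \<Rightarrow> nat \<Rightarrow> (nat \<Rightarrow> real) \<Rightarrow> real poly" where
  "par_sum r i c = (\<Sum>l\<le>i. smult (c l) (geg (2 * l + r)))"

lemma pderiv_par_sum: "pderiv (par_sum r i c) = (\<Sum>l\<le>i. smult (c l) (pderiv (geg (2 * l + r))))"
  by (simp add: par_sum_def pderiv_sum pderiv_smult)

lemma wint_par_sum: "wint (par_sum r i c * par_sum r i c) = (\<Sum>l\<le>i. (c l)\<^sup>2 * gnorm (2 * l + r))"
proof -
  have "wint (par_sum r i c * par_sum r i c) =
      (\<Sum>l\<le>i. \<Sum>l'\<le>i. if l' = l then (c l)\<^sup>2 * gnorm (2 * l + r) else 0)"
    unfolding par_sum_def wint_sum_sum
    by (intro sum.cong) (auto simp: geg_orthogonal gnorm_def power2_eq_square)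
  thus ?thesis by simp
qed

lemma wint_pderiv_par_sum:
  "wint (pderiv (par_sum r i c) * pderiv (par_sum r i c)) =
     (\<Sum>l\<le>i. \<Sum>l'\<le>i. c l * c l' * gdnorm (2 * min l l' + r))"
  unfolding pderiv_par_sum wint_sum_sum wint_pderiv_geg
  by (intro sum.cong) (auto simp: min_def)

text \<open>A quadratic form is at most the Frobenius norm of its matrix times the squared length:
  Cauchy-Schwarz over pairs of indices, with \<open>a\<close> the products of normalised coordinates
  and \<open>b\<close> the normalised entries.\<close>

lemma wint_pderiv_par_sum_le:
  "wint (pderiv (par_sum r i c) * pderiv (par_sum r i c)) \<le>
     sqrt (gT r i) * wint (par_sum r i c * par_sum r i c)"
proof (rule power2_le_imp_le)
  define a where "a = (\<lambda>(l, l'). c l * c l' * sqrt (gnorm (2 * l + r) * gnorm (2 * l' + r)))"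
  define b where "b = (\<lambda>(l, l'). gdnorm (2 * min l l' + r) / sqrt (gnorm (2 * l + r) * gnorm (2 * l' + r)))"
  define I where "I = {..i} \<times> {..i}"
  have pos: "gnorm m \<noteq> 0" "gnorm m \<ge> 0" for m using gnorm_pos[of m] by auto
  have "wint (pderiv (par_sum r i c) * pderiv (par_sum r i c)) = (\<Sum>x\<in>I. a x * b x)"
    unfolding wint_pderiv_par_sum sum.cartesian_product I_def
    by (intro sum.cong) (auto simp: a_def b_def pos)
  also have "\<dots>\<^sup>2 \<le> (\<Sum>x\<in>I. (a x)\<^sup>2) * (\<Sum>x\<in>I. (b x)\<^sup>2)"
    by (rule Cauchy_Schwarz_ineq_sum)
  also have "(\<Sum>x\<in>I. (a x)\<^sup>2) = (\<Sum>l\<le>i. \<Sum>l'\<le>i. ((c l)\<^sup>2 * gnorm (2 * l + r)) * ((c l')\<^sup>2 * gnorm (2 * l' + r)))"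
    unfolding sum.cartesian_product I_def
    by (intro sum.cong) (auto simp: a_def pos power_mult_distrib)
  also have "\<dots> = (wint (par_sum r i c * par_sum r i c))\<^sup>2"
    unfolding wint_par_sum power2_eq_square sum_product ..
  also have "(\<Sum>x\<in>I. (b x)\<^sup>2) = gT r i"
    unfolding gT_def sum.cartesian_product I_def
    by (intro sum.cong) (auto simp: b_def pos power_divide)
  finally show "(wint (pderiv (par_sum r i c) * pderiv (par_sum r i c)))\<^sup>2
      \<le> (sqrt (gT r i) * wint (par_sum r i c * par_sum r i c))\<^sup>2"
    by (simp add: power_mult_distrib gT_nonneg mult.commute)
  show "0 \<le> sqrt (gT r i) * wint (par_sum r i c * par_sum r i c)"
    by (simp add: gT_nonneg wint_square_nonneg)
qed

text \<open>Opposite parities are orthogonal both before and after differentiation, so each block is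
  estimated alone; the even bound is then enlarged to the odd one.\<close>

lemma wint_pderiv_le:
  assumes "degree p \<le> 2 * i + 1"
  shows "wint (pderiv p * pderiv p) \<le> sqrt (gT 1 i) * wint (p * p)"
proof -
  obtain x where x: "p = (\<Sum>m\<le>2 * i + 1. smult (x m) (geg m))"
    using geg_expansion[OF assms] by blast
  define P where "P = (\<lambda>r. par_sum r i (\<lambda>l. x (2 * l + r)))"
  have p: "p = P 0 + P 1"
    unfolding x sum_split_parity P_def par_sum_def ..
  have "2 * l + 0 \<noteq> 2 * l' + (1 :: nat)" for l l' by presburger
  hence "wint (P 0 * P 1) = 0"
    unfolding P_def par_sum_def wint_sum_sum
    by (intro sum.neutral ballI) (simp only: geg_orthogonal mult_zero_right simp_thms)
  hence norm: "wint (p * p) = wint (P 0 * P 0) + wint (P 1 * P 1)"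
    unfolding p by (simp only: distrib_left distrib_right wint_add mult.commute[of "P 1" "P 0"])
  have "wint (pderiv (P 0) * pderiv (P 1)) = 0"
    unfolding P_def pderiv_par_sum wint_sum_sum wint_pderiv_geg by simp
  hence "wint (pderiv p * pderiv p) = wint (pderiv (P 0) * pderiv (P 0)) + wint (pderiv (P 1) * pderiv (P 1))"
    unfolding p by (simp only: pderiv_add distrib_left distrib_right wint_add
        mult.commute[of "pderiv (P 1)" "pderiv (P 0)"])
  also have "\<dots> \<le> sqrt (gT 0 i) * wint (P 0 * P 0) + sqrt (gT 1 i) * wint (P 1 * P 1)"
    unfolding P_def by (intro add_mono wint_pderiv_par_sum_le)
  also have "\<dots> \<le> sqrt (gT 1 i) * wint (P 0 * P 0) + sqrt (gT 1 i) * wint (P 1 * P 1)"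
    by (intro add_mono mult_right_mono) (simp_all add: gT_even_le_odd[unfolded One_nat_def] wint_square_nonneg)
  finally show ?thesis unfolding norm by (simp add: distrib_left)
qed

lemma markov_ratio_le:
  assumes "degree p \<le> 2 * i + 1"
  shows "wnorm lam (poly (pderiv p)) / wnorm lam (poly p) \<le> sqrt (sqrt (gT 1 i))"
proof (cases "wint (p * p) = 0")
  \<comment> \<open>Division by zero yields 0, so the ratio is 0 here.\<close>
  case True
  thus ?thesis by (simp add: wnorm_poly gT_nonneg)
next
  case False
  hence "wint (p * p) > 0" using wint_square_nonneg[of p] by linarith
  moreover have "sqrt (wint (pderiv p * pderiv p)) \<le> sqrt (sqrt (gT 1 i) * wint (p * p))"
    using wint_pderiv_le[OF assms] by simp
  ultimately show ?thesis by (simp add: wnorm_poly real_sqrt_mult divide_le_eq)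
qed

lemma markov_const_bounds:
  fixes i :: nat
  defines "n \<equiv> 2 * i + 1"
  shows "(markov_const n lam)\<^sup>2 \<le> sqrt (gT 1 i)"
    and "degree p \<le> n \<Longrightarrow> wint (pderiv p * pderiv p) \<le> (markov_const n lam)\<^sup>2 * wint (p * p)"
proof -
  let ?A = "{p :: real poly. degree p \<le> n \<and> p \<noteq> 0}"
  let ?q = "\<lambda>p. wnorm lam (poly (pderiv p)) / wnorm lam (poly p)"
  have le: "?q p \<le> sqrt (sqrt (gT 1 i))" if "p \<in> ?A" for p
    using that by (intro markov_ratio_le) (simp add: n_def)
  \<comment> \<open>The constant 1 shows that the supremum is over a nonempty set, and its ratio 0
    that the supremum is nonnegative.\<close>
  have one: "1 \<in> ?A" by simp
  have upper: "markov_const n lam \<le> sqrt (sqrt (gT 1 i))"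
    unfolding markov_const_def using one le by (intro cSUP_least) blast+
  have ge: "?q p \<le> markov_const n lam" if "p \<in> ?A" for p
    unfolding markov_const_def using that le by (intro cSUP_upper) (auto intro!: bdd_aboveI)
  have nonneg: "0 \<le> markov_const n lam"
    using ge[OF one] by (simp add: wnorm_poly wint_0)
  have "(markov_const n lam)\<^sup>2 \<le> (sqrt (sqrt (gT 1 i)))\<^sup>2"
    using upper nonneg by (rule power_mono)
  thus "(markov_const n lam)\<^sup>2 \<le> sqrt (gT 1 i)" by (simp add: gT_nonneg)
  show "wint (pderiv p * pderiv p) \<le> (markov_const n lam)\<^sup>2 * wint (p * p)" if p: "degree p \<le> n"
  proof (cases "wint (p * p) = 0")
    case True
    thus ?thesis using wint_pderiv_le[of p i] p by (simp add: n_def)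
  next
    case False
    hence pos: "wint (p * p) > 0" using wint_square_nonneg[of p] by linarith
    hence "p \<noteq> 0" by (auto simp: wint_0)
    hence "sqrt (wint (pderiv p * pderiv p)) / sqrt (wint (p * p)) \<le> markov_const n lam"
      using ge[of p] p by (simp add: wnorm_poly)
    hence "sqrt (wint (pderiv p * pderiv p)) \<le> markov_const n lam * sqrt (wint (p * p))"
      using pos by (simp add: divide_le_eq)
    hence "(sqrt (wint (pderiv p * pderiv p)))\<^sup>2 \<le> (markov_const n lam * sqrt (wint (p * p)))\<^sup>2"
      by (rule power_mono) (simp add: wint_square_nonneg)
    thus ?thesis by (simp add: wint_square_nonneg power_mult_distrib)
  qed
qed

text \<open>
  If \<open>D\<close> is differentiation and \<open>v\<close> a normalised basis vector, the bound \<open>|D w|\<^sup>2 \<le> M |w|\<^sup>2\<close> is used for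
  \<open>w = B v\<close>: since \<open>|w|\<^sup>2 = \<langle>D w, D v\<rangle>\<close>, the square of \<open>D w - M D v\<close> gives \<open>|B v|\<^sup>2 \<le> M |D v|\<^sup>2\<close>,
  and summing over the basis yields \<open>tr B\<^sup>2 \<le> M tr B\<close>.
\<close>

lemma gT_le:
  assumes M: "M > 0"
    and le: "\<And>p. degree p \<le> 2 * i + 1 \<Longrightarrow> wint (pderiv p * pderiv p) \<le> M * wint (p * p)"
  shows "gT 1 i \<le> M * (\<Sum>l\<le>i. gdnorm (2 * l + 1) / gnorm (2 * l + 1))"
proof -
  have bound: "(\<Sum>l'\<le>i. (gdnorm (2 * min l l' + 1))\<^sup>2 / gnorm (2 * l' + 1)) \<le> M * gdnorm (2 * l + 1)"
    if l: "l \<le> i" for l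
  proof -
    \<comment> \<open>Here \<open>v\<close> is the unnormalised \<open>geg (2 * l + 1)\<close>:
      \<open>p\<close> is \<open>B v\<close>, \<open>F\<close> is \<open>D v\<close>, and the number
      \<open>w\<close> is the squared norm of \<open>p\<close>.\<close>
    define c where "c = (\<lambda>l'. gdnorm (2 * min l l' + 1) / gnorm (2 * l' + 1))"
    define p where "p = par_sum 1 i c"
    define F where "F = pderiv (geg (2 * l + 1))"
    define w where "w = (\<Sum>l'\<le>i. (gdnorm (2 * min l l' + 1))\<^sup>2 / gnorm (2 * l' + 1))"
    have pos: "gnorm m \<noteq> 0" for m using gnorm_pos[of m] by auto
    have "degree p \<le> 2 * i + 1"
      unfolding p_def par_sum_def
      by (intro degree_sum_le order_trans[OF degree_smult_le] order_trans[OF degree_geg_le]) auto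
    moreover have pp: "wint (p * p) = w"
      unfolding p_def wint_par_sum w_def
      by (intro sum.cong) (auto simp: c_def power2_eq_square pos)
    ultimately have pd: "wint (pderiv p * pderiv p) \<le> M * w" using le[of p] by simp
    have pF: "wint (pderiv p * F) = w"
    proof -
      have "wint (pderiv p * F) = (\<Sum>l'\<le>i. c l' * wint (pderiv (geg (2 * l' + 1)) * F))"
        unfolding p_def pderiv_par_sum by (simp add: sum_distrib_right wint_sum wint_smult del: geg.simps)
      also have "\<dots> = w"
        unfolding w_def F_def wint_pderiv_geg
        by (intro sum.cong) (auto simp: c_def power2_eq_square min_def)
      finally show ?thesis .
    qed
    have "(pderiv p - smult M F) * (pderiv p - smult M F) =
        pderiv p * pderiv p - smult (2 * M) (pderiv p * F) + smult (M * M) (F * F)"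
      by (rule poly_ext_real) (simp add: algebra_simps)
    moreover have "wint (F * F) = gdnorm (2 * l + 1)" by (simp only: F_def gdnorm_def)
    ultimately have "0 \<le> wint (pderiv p * pderiv p) - 2 * M * w + M * M * gdnorm (2 * l + 1)"
      using wint_square_nonneg[of "pderiv p - smult M F"]
      by (simp add: wint_add wint_diff wint_smult pF)
    hence "M * w \<le> M * (M * gdnorm (2 * l + 1))" using pd by (simp add: mult.assoc)
    thus ?thesis using M by (simp add: w_def)
  qed
  \<comment> \<open>Dividing by \<open>gnorm (2 * l + 1)\<close> normalises
    \<open>v\<close>.\<close>
  have "gT 1 i = (\<Sum>l\<le>i. (\<Sum>l'\<le>i. (gdnorm (2 * min l l' + 1))\<^sup>2 / gnorm (2 * l' + 1)) / gnorm (2 * l + 1))"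
    by (simp add: gT_def sum_divide_distrib mult.commute)
  also have "\<dots> \<le> (\<Sum>l\<le>i. M * gdnorm (2 * l + 1) / gnorm (2 * l + 1))"
    by (intro sum_mono divide_right_mono bound) (auto simp: gnorm_pos less_imp_le)
  finally show ?thesis by (simp add: sum_distrib_left)
qed

end

theorem theorem4p4:
  fixes n :: nat and lam :: real
  assumes "odd n" and "n \<ge> 3" and "lam > -1/2"
  defines "lam' \<equiv> max lam 0"
  shows "(real n + 1) * (real n + lam + 1/2)\<^sup>2 * (real n + 2*lam + 1)
           / ((2*lam + 1) * (2*lam + 5)) \<le> (markov_const n lam)\<^sup>2
       \<and> (markov_const n lam)\<^sup>2 \<le>
           (real n + 1) powr (3/2) * (real n + 2*lam + 1)\<^sup>2 * sqrt (real n + 2*lam' + 1)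
           / (2 * (2*lam + 1) * sqrt (2*lam + 5))"
proof -
  interpret gegenbauer lam by unfold_locales fact
  obtain i where i: "n = 2 * i + 1" using assms(1) by (elim oddE)
  define y N where "y = real n" "N = (y + 1) * (y + 2 * lam + 1)"
  define a where "a = 2 * lam + 1"
  define M where "M = (markov_const n lam)\<^sup>2"
  define tr where "tr = (\<Sum>l\<le>i. gdnorm (2 * l + 1) / gnorm (2 * l + 1))"
  have y: "y \<ge> 3" using assms(2) by (simp add: y_N_def)
  have a': "2 * lam + 3 = a + 2" "2 * lam + 5 = a + 4" by (simp_all add: a_def)
  have a: "a > 0" using assms(3) by (simp add: a_def)
  have N': "(2 * real i + 2) * (2 * real i + 2 * lam + 2) = N"
    by (simp add: y_N_def i algebra_simps)
  have N: "N > 2"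
  proof -
    have "4 * 3 \<le> N" unfolding y_N_def(2) using y assms(3) by (intro mult_mono) auto
    thus ?thesis by simp
  qed
  have tr: "4 * a * tr = N * (N - 2)"
    using sum_gdnorm_over_gnorm_odd[of i] by (simp only: N' tr_def a_def)
  have tr_pos: "tr > 0"
  proof -
    have "4 * a * tr > 0" unfolding tr using N by simp
    thus ?thesis using a by (simp add: zero_less_mult_iff)
  qed
  have T: "12 * (a\<^sup>2 * (a + 4) * (a + 2)) * gT 1 i = trace_poly lam N"
  proof -
    have "gT 1 i = (\<Sum>l\<le>i. gQ (2 * l + 1))" by (rule gT_eq) simp
    thus ?thesis using sum_gQ_odd[of i] unfolding N' a' a_def[symmetric] by simp
  qed

  have "gT 1 i \<le> ((y + 1) powr (3/2) * (y + 2 * lam + 1)\<^sup>2 * sqrt (y + 2 * lam' + 1) / (2 * a * sqrt (a + 4)))\<^sup>2"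
  proof -
    have "12 * (a\<^sup>2 * (a + 4) * (a + 2)) * gT 1 i \<le> 3 * (a + 2) * ((y+1)^3 * (y+2*lam+1)^4 * (y + 2 * lam' + 1))"
      using trace_poly_upper[OF assms(3) y] unfolding T lam'_def y_N_def(2) a' .
    also have "12 * (a\<^sup>2 * (a + 4) * (a + 2)) * gT 1 i = 3 * (a + 2) * (4 * a\<^sup>2 * (a + 4) * gT 1 i)"
      by algebra
    finally have "4 * a\<^sup>2 * (a + 4) * gT 1 i \<le> (y+1)^3 * (y+2*lam+1)^4 * (y + 2 * lam' + 1)"
      using a by (subst (asm) mult_le_cancel_left_pos) auto
    hence "gT 1 i \<le> (y+1)^3 * (y+2*lam+1)^4 * (y + 2 * lam' + 1) / (4 * a\<^sup>2 * (a + 4))"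
      using a by (subst pos_le_divide_eq) (auto simp: mult.commute)
    also have "(y + 1)^3 = ((y + 1) powr (3/2))\<^sup>2"
      using y by (simp add: powr_power)
    also have "(y+2*lam+1)^4 = ((y+2*lam+1)\<^sup>2)\<^sup>2"
      by simp
    also have "y + 2 * lam' + 1 = (sqrt (y + 2 * lam' + 1))\<^sup>2"
      using y by (simp add: lam'_def)
    also have "4 * a\<^sup>2 * (a + 4) = (2 * a * sqrt (a + 4))\<^sup>2"
      using a by (simp add: power_mult_distrib)
    finally show ?thesis by (simp only: power_mult_distrib power_divide)
  qed
  hence "sqrt (gT 1 i) \<le> (y + 1) powr (3/2) * (y + 2 * lam + 1)\<^sup>2 * sqrt (y + 2 * lam' + 1) / (2 * a * sqrt (a + 4))"
    using a y by (intro real_le_lsqrt) (auto simp: gT_nonneg lam'_def)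
  hence upper: "M \<le> (y + 1) powr (3/2) * (y + 2 * lam + 1)\<^sup>2 * sqrt (y + 2 * lam' + 1) / (2 * a * sqrt (a + 4))"
    using markov_const_bounds(1)[of i] by (simp add: M_def i)

  \<comment> \<open>Up to the factor \<open>12 * a * (a + 2)\<close> this compares
    \<open>tr B\<^sup>2\<close>, which is \<open>gT 1 i\<close>, with \<open>tr B\<close>, which is
    \<open>tr\<close>.\<close>
  have "3 * (a + 2) * (N\<^sup>2 * (N - 2)) * (y + lam + 1/2)\<^sup>2 \<le> 12 * (a\<^sup>2 * (a + 4) * (a + 2)) * gT 1 i"
    using trace_poly_lower[OF assms(3) y] unfolding T y_N_def(2) a' .
  also have "12 * (a\<^sup>2 * (a + 4) * (a + 2)) * gT 1 i = (12 * a * (a + 2)) * (a * (a + 4) * gT 1 i)"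
    by algebra
  also have "3 * (a + 2) * (N\<^sup>2 * (N - 2)) * (y + lam + 1/2)\<^sup>2
      = (12 * a * (a + 2)) * (tr * (N * (y + lam + 1/2)\<^sup>2))"
    using tr by algebra
  finally have low: "tr * (N * (y + lam + 1/2)\<^sup>2) \<le> a * (a + 4) * gT 1 i"
    using a by (subst (asm) mult_le_cancel_left_pos) auto
  have le: "wint (pderiv p * pderiv p) \<le> M * wint (p * p)" if "degree p \<le> 2 * i + 1" for p
    using markov_const_bounds(2)[of p i] that by (simp add: M_def i)
  have "M > 0"
  proof (rule ccontr)
    assume "\<not> M > 0"
    hence "M = 0" by (simp add: M_def)
    \<comment> \<open>\<open>geg 1\<close> is the monomial of degree one, with derivative 1, so
      \<open>M = 0\<close> would force \<open>wint 1 \<le> 0\<close>.\<close>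
    have "wint (pderiv (geg 1) * pderiv (geg 1)) \<le> M * wint (geg 1 * geg 1)"
      using degree_geg_le[of 1] by (intro le) simp
    thus False using \<open>M = 0\<close> wint_1_pos by (simp add: pderiv_pCons one_pCons)
  qed
  hence "gT 1 i \<le> M * tr" unfolding tr_def by (rule gT_le) (rule le)
  hence "a * (a + 4) * gT 1 i \<le> a * (a + 4) * (M * tr)"
    using a by (intro mult_left_mono) auto
  hence "tr * (N * (y + lam + 1/2)\<^sup>2) \<le> tr * (a * (a + 4) * M)" using low by (simp add: mult_ac)
  hence "N * (y + lam + 1/2)\<^sup>2 \<le> a * (a + 4) * M" using tr_pos by simp
  hence "N * (y + lam + 1/2)\<^sup>2 / (a * (a + 4)) \<le> M"
    using a by (subst pos_divide_le_eq) (auto simp: mult.commute)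
  moreover have "N * (y + lam + 1/2)\<^sup>2 = (y + 1) * (y + lam + 1/2)\<^sup>2 * (y + 2 * lam + 1)"
    by (simp add: y_N_def)
  ultimately show ?thesis using upper unfolding a' y_N_def(1) M_def a_def by simp
qed

end
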